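(* Let $f:2^V\to\mathbb{R}_+$ be a normalized ($f(\emptyset)=0$) monotone submodular function with $f(\{v\})>0$ for all $v\in V$. Let $\hat S_1,\dots,\hat S_k$ with densities $\lambda_1,\dots,\lambda_k$ be the deletion-variant dense decomposition of $f$, and let $T_1,\dots,T_{k'}$ with densities $\hat\lambda_1,\dots,\hat\lambda_{k'}$ be the contraction-variant dense decomposition of $f$. Then (i) $k'=k$, (ii) $\hat S_i=T_i$ for all $1\le i\le k$, and (iii) $\hat\lambda_i=1/\lambda_i$ for $1\le i\le k$.
   Context: Deletion variant: let $S_0=V$; for $i\ge1$, while $S_{i-1}\neq\emptyset$, let $S_i\subsetneq S_{i-1}$ be the unique minimal set minimizing $\frac{|S_{i-1}|-|S|}{f(S_{i-1})-f(S)}$ over $S\subsetneq S_{i-1}$; set $\hat S_i=S_{i-1}\setminus S_i$ and $\lambda_i=\frac{|S_{i-1}|-|S_i|}{f(S_{i-1})-f(S_i)}$; the process ends when $S_k=\emptyset$. Contraction variant: let $g(X)=f(V)-f(V\setminus X)$, a normalized monotone supermodular function. Let $T_1$ be the unique maximal set maximizing $g(T)/|T|$ over nonempty $T\subseteq V$, with density $\hat\lambda_1$; then contract, i.e. consider $g_{T_1}(A)=g(T_1\cup A)-g(T_1)$ on $V\setminus T_1$, let $T_2$ be its unique maximal densest set with density $\hat\lambda_2$, and continue until $V$ is partitioned into $T_1,\dots,T_{k'}$. *)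

theory Defs
  imports "HOL-Library.Extended_Real"
begin

definition submodular_on :: "'a set \<Rightarrow> ('a set \<Rightarrow> real) \<Rightarrow> bool" where
  "submodular_on V f \<longleftrightarrow>
     (\<forall>A B. A \<subseteq> V \<longrightarrow> B \<subseteq> V \<longrightarrow> f (A \<union> B) + f (A \<inter> B) \<le> f A + f B)"

text \<open>
  The quotient is taken in the extended reals, where a positive number divided by 0 is
  \<open>\<infinity>\<close>: for monotone \<open>f\<close>, a proper subset \<open>S\<close> of \<open>R\<close> with \<open>f S = f R\<close> has
  ratio \<open>\<infinity>\<close> (real division would make it 0 and hence a spurious minimizer).
\<close>

definition deletion_ratio :: "('a set \<Rightarrow> real) \<Rightarrow> 'a set \<Rightarrow> 'a set \<Rightarrow> ereal" where
  "deletion_ratio f R S = ereal (real (card R) - real (card S)) / ereal (f R - f S)"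

definition is_deletion_minimizer :: "('a set \<Rightarrow> real) \<Rightarrow> 'a set \<Rightarrow> 'a set \<Rightarrow> bool" where
  "is_deletion_minimizer f R S \<longleftrightarrow> is_arg_min (deletion_ratio f R) (\<lambda>S'. S' \<subset> R) S"

definition deletion_step :: "('a set \<Rightarrow> real) \<Rightarrow> 'a set \<Rightarrow> 'a set" where
  "deletion_step f R =
     (THE S. is_deletion_minimizer f R S \<and> \<not> (\<exists>S'. is_deletion_minimizer f R S' \<and> S' \<subset> S))"

text \<open>
  The sets \<open>S\<^sub>i\<close>. Only the indices up to \<open>deletion_length\<close> are meaningful; later values
  are unspecified.
\<close>

primrec deletion_set :: "'a set \<Rightarrow> ('a set \<Rightarrow> real) \<Rightarrow> nat \<Rightarrow> 'a set" where
  "deletion_set V f 0 = V"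
| "deletion_set V f (Suc i) = deletion_step f (deletion_set V f i)"

definition deletion_length :: "'a set \<Rightarrow> ('a set \<Rightarrow> real) \<Rightarrow> nat" where
  "deletion_length V f = (LEAST k. deletion_set V f k = {})"

text \<open>Parts and densities are indexed from 1, in both variants.\<close>

definition deletion_part :: "'a set \<Rightarrow> ('a set \<Rightarrow> real) \<Rightarrow> nat \<Rightarrow> 'a set" where
  "deletion_part V f i = deletion_set V f (i - 1) - deletion_set V f i"

definition deletion_density :: "'a set \<Rightarrow> ('a set \<Rightarrow> real) \<Rightarrow> nat \<Rightarrow> ereal" where
  "deletion_density V f i = deletion_ratio f (deletion_set V f (i - 1)) (deletion_set V f i)"

definition dual_fun :: "'a set \<Rightarrow> ('a set \<Rightarrow> real) \<Rightarrow> 'a set \<Rightarrow> real" where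
  "dual_fun V f X = f V - f (V - X)"

definition contract :: "('a set \<Rightarrow> real) \<Rightarrow> 'a set \<Rightarrow> 'a set \<Rightarrow> real" where
  "contract h T A = h (T \<union> A) - h T"

definition set_density :: "('a set \<Rightarrow> real) \<Rightarrow> 'a set \<Rightarrow> real" where
  "set_density h T = h T / real (card T)"

definition is_densest :: "'a set \<Rightarrow> ('a set \<Rightarrow> real) \<Rightarrow> 'a set \<Rightarrow> bool" where
  "is_densest W h T \<longleftrightarrow> is_arg_max (set_density h) (\<lambda>T'. T' \<noteq> {} \<and> T' \<subseteq> W) T"

definition max_densest :: "'a set \<Rightarrow> ('a set \<Rightarrow> real) \<Rightarrow> 'a set" where
  "max_densest W h = (THE T. is_densest W h T \<and> \<not> (\<exists>T'. is_densest W h T' \<and> T \<subset> T'))"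

text \<open>
  The remaining ground set and the current contracted function after \<open>i\<close> contractions.
  Only the indices up to \<open>contraction_length\<close> are meaningful.
\<close>

primrec contraction_state ::
    "'a set \<Rightarrow> ('a set \<Rightarrow> real) \<Rightarrow> nat \<Rightarrow> 'a set \<times> ('a set \<Rightarrow> real)" where
  "contraction_state V f 0 = (V, dual_fun V f)"
| "contraction_state V f (Suc i) =
     (case contraction_state V f i of (W, h) \<Rightarrow>
        (W - max_densest W h, contract h (max_densest W h)))"

definition contraction_length :: "'a set \<Rightarrow> ('a set \<Rightarrow> real) \<Rightarrow> nat" where
  "contraction_length V f = (LEAST k. fst (contraction_state V f k) = {})"

definition contraction_part :: "'a set \<Rightarrow> ('a set \<Rightarrow> real) \<Rightarrow> nat \<Rightarrow> 'a set" where
  "contraction_part V f i = (case contraction_state V f (i - 1) of (W, h) \<Rightarrow> max_densest W h)"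

definition contraction_density :: "'a set \<Rightarrow> ('a set \<Rightarrow> real) \<Rightarrow> nat \<Rightarrow> real" where
  "contraction_density V f i =
     set_density (snd (contraction_state V f (i - 1))) (contraction_part V f i)"

end

theory Submission imports Defs begin

text \<open>
  Complementation \<open>S \<mapsto> R - S\<close> turns the deletion ratio of \<open>S\<close> into the reciprocal of the
  density of \<open>R - S\<close> for the dual function of \<open>f\<close> on \<open>R\<close>, so it exchanges minimal minimizers
  with maximal densest sets; the latter are unique because densest sets of a supermodular
  function are closed under union. Moreover, contracting the dual function on \<open>R\<close> by \<open>T\<close> gives
  the dual function on \<open>R - T\<close>, so both processes stay in step.
\<close>

definition supermodular_on :: "'a set \<Rightarrow> ('a set \<Rightarrow> real) \<Rightarrow> bool" where
  "supermodular_on W h \<longleftrightarrow>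
     (\<forall>A B. A \<subseteq> W \<longrightarrow> B \<subseteq> W \<longrightarrow> h A + h B \<le> h (A \<union> B) + h (A \<inter> B))"

lemma submodular_on_subset: "submodular_on V f \<Longrightarrow> R \<subseteq> V \<Longrightarrow> submodular_on R f"
  unfolding submodular_on_def by (meson subset_trans)

lemma dual_fun_empty [simp]: "dual_fun R f {} = 0"
  by (simp add: dual_fun_def)

lemma dual_fun_Diff: "S \<subseteq> R \<Longrightarrow> dual_fun R f (R - S) = f R - f S"
  by (simp add: dual_fun_def double_diff)

lemma dual_fun_nonneg: "mono_on (Pow R) f \<Longrightarrow> 0 \<le> dual_fun R f X"
  by (auto simp: dual_fun_def mono_on_def)

text \<open>The term \<open>f R\<close> cancels in the difference, leaving
  \<open>f (R - T) - f (R - T - A)\<close>. Being an equation between functions, it rewrites the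
  contracted state directly.\<close>

lemma contract_dual_fun: "contract (dual_fun R f) T = dual_fun (R - T) f"
proof -
  have "R - (T \<union> A) = R - T - A" for A
    by blast
  then show ?thesis
    by (simp add: fun_eq_iff contract_def dual_fun_def)
qed

text \<open>By De Morgan, complements in \<open>R\<close> exchange union and intersection, and the
  minus sign before \<open>f\<close> reverses the inequality.\<close>

lemma supermodular_on_dual_fun:
  assumes "submodular_on R f"
  shows "supermodular_on R (dual_fun R f)"
  unfolding supermodular_on_def
proof (intro allI impI)
  fix A B
  have "f ((R - A) \<union> (R - B)) + f ((R - A) \<inter> (R - B)) \<le> f (R - A) + f (R - B)"
    using assms by (simp add: submodular_on_def)
  then show "dual_fun R f A + dual_fun R f B \<le> dual_fun R f (A \<union> B) + dual_fun R f (A \<inter> B)"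
    by (simp add: dual_fun_def Diff_Un Diff_Int)
qed

lemma is_densest_alt:
  "is_densest W h T \<longleftrightarrow>
     T \<noteq> {} \<and> T \<subseteq> W \<and> (\<forall>T'. T' \<noteq> {} \<longrightarrow> T' \<subseteq> W \<longrightarrow> set_density h T' \<le> set_density h T)"
  unfolding is_densest_def is_arg_max_linorder by blast

text \<open>Uncrossing: with \<open>d\<close> the maximum density, \<open>h T - d * card T\<close>
  is supermodular, at most 0 on subsets of \<open>W\<close>, and 0 at \<open>A\<close> and
  \<open>B\<close>. Its values at union and intersection sum to at least 0, and the one at the
  intersection is at most 0, so the union has density at least \<open>d\<close>.\<close>

lemma is_densest_Un:
  assumes "finite W" "h {} = 0" "supermodular_on W h" "is_densest W h A" "is_densest W h B"
  shows "is_densest W h (A \<union> B)"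
proof -
  define d where "d = set_density h A"
  have A: "A \<noteq> {}" "A \<subseteq> W" and B: "B \<noteq> {}" "B \<subseteq> W"
    using assms by (auto simp: is_densest_alt)
  have fin: "finite A" "finite B"
    using A B assms(1) finite_subset by auto
  have max: "set_density h T \<le> d" if "T \<noteq> {}" "T \<subseteq> W" for T
    using assms(4) that by (simp add: is_densest_alt d_def)
  have dB: "set_density h B = d"
    using assms(4,5) unfolding is_densest_alt d_def by (meson order_antisym)
  \<comment> \<open>The product form covers the empty set as well, through \<open>h {} = 0\<close>;
    this matters because \<open>A\<close> and \<open>B\<close> may be disjoint.\<close>
  have le: "h T \<le> d * card T" if "T \<subseteq> W" for T
  proof (cases "T = {}")
    case False
    then have "0 < card T"
      using that assms(1) finite_subset card_gt_0_iff by blast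
    then show ?thesis
      using max[OF False that] by (simp add: set_density_def field_simps)
  qed (simp add: assms(2))
  have eq: "h A = d * card A" "h B = d * card B"
    using A B fin d_def dB by (auto simp: set_density_def field_simps)
  have "card A + card B = card (A \<union> B) + card (A \<inter> B)"
    using card_Un_Int fin by blast
  then have "d * card A + d * card B = d * card (A \<union> B) + d * card (A \<inter> B)"
    by (metis distrib_left of_nat_add)
  moreover have "h A + h B \<le> h (A \<union> B) + h (A \<inter> B)"
    using assms(3) A B unfolding supermodular_on_def by blast
  moreover have "h (A \<inter> B) \<le> d * card (A \<inter> B)"
    using A by (intro le) auto
  ultimately have "d * card (A \<union> B) \<le> h (A \<union> B)"
    using eq by linarith
  moreover have "0 < card (A \<union> B)"
    using A fin by (simp add: card_gt_0_iff)
  ultimately have "d \<le> set_density h (A \<union> B)"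
    by (simp add: set_density_def field_simps)
  then show ?thesis
    using A B max unfolding is_densest_alt by (meson Un_empty Un_least order_trans)
qed

lemma ex_is_densest:
  assumes "finite W" "W \<noteq> {}"
  shows "\<exists>T. is_densest W h T"
proof -
  let ?P = "{T. T \<noteq> {} \<and> T \<subseteq> W}"
  have fin: "finite ?P" and ne: "?P \<noteq> {}"
    using assms by auto
  have "Max (set_density h ` ?P) \<in> set_density h ` ?P"
    using fin ne by (intro Max_in) auto
  then obtain T where T: "Max (set_density h ` ?P) = set_density h T" "T \<in> ?P"
    by (rule imageE)
  have "set_density h T' \<le> set_density h T" if "T' \<in> ?P" for T'
    unfolding T(1)[symmetric] using fin that by (intro Max_ge) auto
  then have "is_densest W h T"
    using T(2) by (simp add: is_densest_alt)
  then show ?thesis ..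
qed

text \<open>Finiteness gives a maximal densest set \<open>M\<close>. Its union with any densest
  \<open>T\<close> is densest again, so \<open>T\<close> lies in \<open>M\<close>. Hence
  \<open>M\<close> is the greatest densest set and the only maximal one, as \<open>THE\<close>
  demands.\<close>

lemma max_densest:
  assumes "finite W" "W \<noteq> {}" "h {} = 0" "supermodular_on W h"
  shows is_densest_max_densest: "is_densest W h (max_densest W h)"
    and subset_max_densest: "is_densest W h T \<Longrightarrow> T \<subseteq> max_densest W h"
proof -
  have "finite {T. is_densest W h T}"
    by (rule finite_subset[of _ "Pow W"]) (auto simp: is_densest_alt assms(1))
  then obtain M where M: "is_densest W h M" "\<And>T. is_densest W h T \<Longrightarrow> M \<subseteq> T \<Longrightarrow> M = T"
    using finite_has_maximal[of "{T. is_densest W h T}"] ex_is_densest[OF assms(1,2)] by auto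
  have greatest: "T \<subseteq> M" if "is_densest W h T" for T
    using M(2)[OF is_densest_Un[OF assms(1,3,4) M(1) that]] by blast
  have "max_densest W h = M"
    unfolding max_densest_def using M(1) greatest by (intro the_equality) blast+
  then show "is_densest W h (max_densest W h)"
    and "is_densest W h T \<Longrightarrow> T \<subseteq> max_densest W h"
    using M(1) greatest by auto
qed

text \<open>Density 0 is covered too: its reciprocal in the extended reals is \<open>\<infinity>\<close>.\<close>

lemma deletion_ratio_eq_inverse_density:
  assumes "finite R" "S \<subset> R"
  shows "deletion_ratio f R S = 1 / ereal (set_density (dual_fun R f) (R - S))"
proof -
  have "card S < card R"
    using assms by (simp add: psubset_card_mono)
  moreover have "card (R - S) = card R - card S"
    using assms by (meson card_Diff_subset finite_subset psubset_imp_subset)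
  ultimately show ?thesis
    using assms(2)
    by (auto simp: deletion_ratio_def set_density_def dual_fun_Diff divide_ereal_def
        divide_inverse)
qed

text \<open>Reciprocals reverse the order on nonnegative numbers, including 0, whose reciprocal is
  infinite. Density 0 arises from proper subsets \<open>S\<close> of \<open>R\<close> with
  \<open>f S = f R\<close>.\<close>

lemma ereal_one_divide_le_iff:
  assumes "0 \<le> a" "0 \<le> b"
  shows "1 / ereal a \<le> 1 / ereal b \<longleftrightarrow> b \<le> a"
  using assms by (auto simp: divide_ereal_def field_simps)

lemma is_deletion_minimizer_iff_is_densest:
  assumes "finite R" "mono_on (Pow R) f"
  shows "is_deletion_minimizer f R S \<longleftrightarrow> S \<subset> R \<and> is_densest R (dual_fun R f) (R - S)"
proof -
  let ?d = "set_density (dual_fun R f)"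
  have nonneg: "0 \<le> ?d T" for T
    using dual_fun_nonneg[OF assms(2)] by (simp add: set_density_def)
  have ratio: "deletion_ratio f R S \<le> deletion_ratio f R S' \<longleftrightarrow> ?d (R - S') \<le> ?d (R - S)"
    if "S \<subset> R" "S' \<subset> R" for S S'
    using that assms(1) nonneg by (simp add: deletion_ratio_eq_inverse_density ereal_one_divide_le_iff)
  \<comment> \<open>Complementation maps the proper subsets of \<open>R\<close> onto its nonempty
    subsets; the preimage of \<open>T\<close> is \<open>R - T\<close>.\<close>
  have compl: "(\<forall>S'. S' \<subset> R \<longrightarrow> Q (R - S')) \<longleftrightarrow> (\<forall>T. T \<noteq> {} \<longrightarrow> T \<subseteq> R \<longrightarrow> Q T)" for Q
  proof (intro iffI allI impI)
    fix T assume "\<forall>S'. S' \<subset> R \<longrightarrow> Q (R - S')" "T \<noteq> {}" "T \<subseteq> R"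
    then show "Q T"
      using double_diff[of T R R] by (auto dest!: spec[of _ "R - T"])
  qed auto
  have "is_deletion_minimizer f R S \<longleftrightarrow>
      S \<subset> R \<and> (\<forall>S'. S' \<subset> R \<longrightarrow> deletion_ratio f R S \<le> deletion_ratio f R S')"
    unfolding is_deletion_minimizer_def is_arg_min_linorder ..
  also have "\<dots> \<longleftrightarrow> S \<subset> R \<and> (\<forall>S'. S' \<subset> R \<longrightarrow> ?d (R - S') \<le> ?d (R - S))"
    by (simp add: ratio cong: conj_cong)
  also have "\<dots> \<longleftrightarrow> S \<subset> R \<and> (\<forall>T. T \<noteq> {} \<longrightarrow> T \<subseteq> R \<longrightarrow> ?d T \<le> ?d (R - S))"
    by (simp only: compl[of "\<lambda>T. ?d T \<le> ?d (R - S)"])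
  also have "\<dots> \<longleftrightarrow> S \<subset> R \<and> is_densest R (dual_fun R f) (R - S)"
    unfolding is_densest_alt by blast
  finally show ?thesis .
qed

lemma deletion_step_eq:
  assumes "finite R" "R \<noteq> {}" "mono_on (Pow R) f" "submodular_on R f"
  shows "deletion_step f R = R - max_densest R (dual_fun R f)"
proof -
  let ?M = "max_densest R (dual_fun R f)"
  note super = supermodular_on_dual_fun[OF assms(4)]
  note iff = is_deletion_minimizer_iff_is_densest[OF assms(1,3)]
  have M: "is_densest R (dual_fun R f) ?M"
    using assms super by (intro is_densest_max_densest) auto
  then have "?M \<noteq> {}" "?M \<subseteq> R"
    by (auto simp: is_densest_alt)
  then have min: "is_deletion_minimizer f R (R - ?M)"
    using M by (auto simp: iff double_diff)
  \<comment> \<open>Complements reverse inclusion, so the greatest densest set yields a least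
    minimizer, hence a unique minimal one.\<close>
  have least: "R - ?M \<subseteq> S" if "is_deletion_minimizer f R S" for S
    using subset_max_densest[OF assms(1,2) dual_fun_empty super, of "R - S"] that by (auto simp: iff)
  show ?thesis
    unfolding deletion_step_def using min least by (intro the_equality) blast+
qed

theorem theorem5:
  fixes V :: "'a set" and f :: "'a set \<Rightarrow> real"
  assumes "finite V"
    and "\<And>A. A \<subseteq> V \<Longrightarrow> 0 \<le> f A"
    and "f {} = 0"
    and "mono_on (Pow V) f"
    and "submodular_on V f"
    and "\<And>v. v \<in> V \<Longrightarrow> 0 < f {v}"
  shows "contraction_length V f = deletion_length V f
    \<and> (\<forall>i\<in>{1..deletion_length V f}. deletion_part V f i = contraction_part V f i)
    \<and> (\<forall>i\<in>{1..deletion_length V f}.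
          ereal (contraction_density V f i) = 1 / deletion_density V f i)"
proof -
  let ?S = "deletion_set V f" and ?k = "deletion_length V f"
  let ?M = "\<lambda>R. max_densest R (dual_fun R f)"
  have step: "deletion_step f R = R - ?M R" "?M R \<subseteq> R" "?M R \<noteq> {}" if "R \<subseteq> V" "R \<noteq> {}" for R
  proof -
    have R: "finite R" "mono_on (Pow R) f" "submodular_on R f"
      using finite_subset[OF that(1) assms(1)] mono_on_subset[OF assms(4) Pow_mono[OF that(1)]]
        submodular_on_subset[OF assms(5) that(1)] by simp_all
    show "deletion_step f R = R - ?M R"
      by (rule deletion_step_eq[OF R(1) that(2) R(2,3)])
    have "is_densest R (dual_fun R f) (?M R)"
      using that R by (intro is_densest_max_densest supermodular_on_dual_fun) auto
    then show "?M R \<subseteq> R" "?M R \<noteq> {}"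
      by (auto simp: is_densest_alt)
  qed
  \<comment> \<open>Each step from a nonempty set removes at least one element. Nonemptiness of all
    earlier sets is required, as \<open>deletion_step\<close> is unspecified at the empty
    set.\<close>
  have bound: "?S n \<subseteq> V \<and> card (?S n) + n \<le> card V" if "\<forall>i<n. ?S i \<noteq> {}" for n
    using that
  proof (induction n)
    case (Suc n)
    then have IH: "?S n \<subseteq> V" "card (?S n) + n \<le> card V" and ne: "?S n \<noteq> {}"
      by auto
    have "?S (Suc n) \<subset> ?S n"
      using step[OF IH(1) ne] by auto
    moreover from this have "card (?S (Suc n)) < card (?S n)"
      using IH(1) assms(1) by (meson finite_subset psubset_card_mono)
    ultimately show ?case
      using IH by auto
  qed simp
  \<comment> \<open>Otherwise \<open>bound\<close> would apply to more than \<open>card V\<close>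
    steps. Existence is what gives the \<open>LEAST\<close> in \<open>deletion_length\<close> its
    meaning.\<close>
  have "\<exists>k. ?S k = {}"
    by (rule ccontr) (use bound[of "Suc (card V)"] in simp)
  then have final: "?S ?k = {}"
    unfolding deletion_length_def by (rule LeastI_ex)
  have ne: "?S i \<noteq> {}" if "i < ?k" for i
    using not_less_Least[OF that[unfolded deletion_length_def]] .
  have sub: "?S i \<subseteq> V" if "i \<le> ?k" for i
    using bound[of i] ne that by auto
  have state: "contraction_state V f i = (?S i, dual_fun (?S i) f)" if "i \<le> ?k" for i
    using that
  proof (induction i)
    case (Suc i)
    then show ?case
      using step(1)[OF sub ne, of i] by (simp add: contract_dual_fun)
  qed simp
  have "contraction_length V f = ?k"
    unfolding contraction_length_def
  proof (rule Least_equality)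
    \<comment> \<open>Before index \<open>?k\<close> both processes have the same ground set, which
      is nonempty there.\<close>
    show "?k \<le> i" if "fst (contraction_state V f i) = {}" for i
    proof (rule ccontr)
      assume "\<not> ?k \<le> i"
      then show False
        using that state[of i] ne[of i] by simp
    qed
  qed (simp add: state final)
  moreover have "deletion_part V f i = contraction_part V f i \<and>
      ereal (contraction_density V f i) = 1 / deletion_density V f i"
    if i: "i \<in> {1..?k}" for i
  proof -
    \<comment> \<open>Parts count from 1 and states from 0, so part \<open>i\<close> is cut from the
      ground set with index \<open>j = i - 1\<close>.\<close>
    obtain j where j: "i = Suc j" "j < ?k"
      using i by (cases i) auto
    let ?R = "?S j"
    have R: "?R \<subseteq> V" "?R \<noteq> {}"
      using sub ne j by auto
    note M = step[OF R]
    have part: "contraction_part V f i = ?M ?R"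
      using j by (simp add: contraction_part_def state)
    have S: "?S i = ?R - ?M ?R"
      using M(1) j by simp
    have "?S i \<subset> ?R"
      using M(2,3) S by auto
    then have "deletion_density V f i = 1 / ereal (set_density (dual_fun ?R f) (?R - ?S i))"
      using deletion_ratio_eq_inverse_density[OF finite_subset[OF R(1) assms(1)], of "?S i" f] j
      by (simp add: deletion_density_def)
    moreover have compl: "?R - ?S i = ?M ?R"
      using M(2) by (simp add: S double_diff)
    \<comment> \<open>For \<open>d = 0\<close> the inner quotient is infinite, and its reciprocal is
      0 again.\<close>
    moreover have "1 / (1 / ereal d) = ereal d" if "0 \<le> d" for d
      using that by (cases "d = 0") (auto simp: divide_ereal_def one_ereal_def)
    moreover have "0 \<le> set_density (dual_fun ?R f) T" for T
      using assms(4) R(1) mono_on_subset[of "Pow V" f "Pow ?R"]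
      by (auto simp: set_density_def dual_fun_nonneg Pow_mono)
    ultimately have "ereal (contraction_density V f i) = 1 / deletion_density V f i"
      using j part by (simp add: contraction_density_def state)
    moreover have "deletion_part V f i = contraction_part V f i"
      using compl part j by (simp add: deletion_part_def)
    ultimately show ?thesis
      by simp
  qed
  ultimately show ?thesis
    by simp
qed

end
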